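(* In the Benders decomposition setting of the context, let $(x^o,\theta^o)\in\mathcal E$ be a guiding point and let $(x',\theta')\in\mathcal X\times\mathbb R_+$ be a point violating at least one Benders cut. Then the closest cut selection method and the Conforti--Wolsey deepest cut selection method are equivalent: their selection problems select the same cuts, i.e., up to multiplication of $(\pi,\pi_0)$ by a positive scalar (which does not change the cut), the optimal solutions of the closest cut selection problem $$\min_{(\pi,\pi_0)\in\Pi}\ \frac{-\pi^\top(b-Bx^o)+\theta^o\pi_0}{\pi^\top B(x^o-x')+\pi_0(\theta^o-\theta')}\quad\text{s.t.}\quad \pi^\top B(x^o-x')+\pi_0(\theta^o-\theta')>0$$ are exactly the optimal solutions of the Conforti--Wolsey deepest cut selection problem $$\max_{(\pi,\pi_0)\in\Pi}\ \pi^\top(b-Bx')-\pi_0\theta'\quad\text{s.t.}\quad \pi^\top B(x^o-x')+\pi_0(\theta^o-\theta')=1.$$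
   Context: Consider the two-stage problem $\min_{x\in\mathcal X}\ f^\top x+\mathcal Q(x)$ with $\mathcal X\subseteq\mathbb R^{n_1}_+$ and value function $\mathcal Q(x)=\min\{c^\top y:\ Ay\ge b-Bx,\ y\in\mathbb R^n_+\}$ (value $+\infty$ if infeasible), where $c\ge0$, $A\in\mathbb R^{m\times n}$, $B\in\mathbb R^{m\times n_1}$, $b\in\mathbb R^m$. Let $$\Pi=\{(\pi,\pi_0)\in\mathbb R^m_+\times\mathbb R_+:\ A^\top\pi-\pi_0c\le0\}.$$ Each $(\pi,\pi_0)\in\Pi$ defines a Benders cut $\pi^\top(b-Bx)-\pi_0\theta\le0$ on $(x,\theta)$; a point violates the cut if the left-hand side is strictly positive at that point. Let $\mathcal E=\{(x,\theta)\in\mathbb R^{n_1}_+\times\mathbb R_+:\ \theta\ge\mathcal Q(x)\}$, which consists exactly of the points of $\mathbb R^{n_1}_+\times\mathbb R_+$ violating no Benders cut. Cut selection: given a positively homogeneous function $h:\Pi\to\mathbb R$, the selection problem is $\max\{\pi^\top(b-Bx')-\pi_0\theta' :\ (\pi,\pi_0)\in\Pi,\ h(\pi,\pi_0)=1\}$, and the selected cut is the one defined by an optimal solution. The Conforti--Wolsey deepest cut selection method uses the pseudonorm $h_{CW}(\pi,\pi_0)=\pi^\top B(x^o-x')+\pi_0(\theta^o-\theta')$. The closest cut selection method selects the violated cut whose hyperplane intersects the half-line $\{(x^o,\theta^o)+\beta(x'-x^o,\theta'-\theta^o):\beta\ge0\}$ nearest to $(x^o,\theta^o)$; the intersection parameter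 is $\beta=\dfrac{-\pi^\top(b-Bx^o)+\theta^o\pi_0}{\pi^\top B(x^o-x')+\pi_0(\theta^o-\theta')}$, and the selection problem minimizes $\beta$ over $(\pi,\pi_0)\in\Pi$ with positive denominator. *)

theory Defs
  imports "HOL-Analysis.Analysis"
begin

text \<open>
  The order on \<open>real ^ 'n\<close> is the componentwise one. A point of the \<open>(x, \<theta>)\<close>-space and a
  multiplier \<open>(\<pi>, \<pi>\<^sub>0)\<close> are both pairs of a vector and a real.
\<close>

text \<open>
  The infimum is taken in \<open>ereal\<close>, so that it is \<open>\<infinity>\<close> when the second-stage problem is infeasible.
  In the feasible case it is a minimum as soon as \<open>c \<ge> 0\<close>, a linear program that is bounded
  below attaining its optimum.
\<close>

definition value_function ::
  "real ^ 'n \<Rightarrow> real ^ 'n ^ 'm \<Rightarrow> real ^ 'k ^ 'm \<Rightarrow> real ^ 'm \<Rightarrow> real ^ 'k \<Rightarrow> ereal" where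
  "value_function c A B b x = (INF y \<in> {y. 0 \<le> y \<and> b - B *v x \<le> A *v y}. ereal (c \<bullet> y))"

definition value_epigraph ::
  "real ^ 'n \<Rightarrow> real ^ 'n ^ 'm \<Rightarrow> real ^ 'k ^ 'm \<Rightarrow> real ^ 'm \<Rightarrow> ((real ^ 'k) \<times> real) set" where
  "value_epigraph c A B b = {(x, \<theta>). 0 \<le> x \<and> 0 \<le> \<theta> \<and> value_function c A B b x \<le> ereal \<theta>}"

definition cut_cone :: "real ^ 'n \<Rightarrow> real ^ 'n ^ 'm \<Rightarrow> ((real ^ 'm) \<times> real) set" where
  "cut_cone c A = {(\<pi>, \<pi>\<^sub>0). 0 \<le> \<pi> \<and> 0 \<le> \<pi>\<^sub>0 \<and> transpose A *v \<pi> - \<pi>\<^sub>0 *\<^sub>R c \<le> 0}"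

definition cut_lhs ::
  "real ^ 'k ^ 'm \<Rightarrow> real ^ 'm \<Rightarrow> (real ^ 'm) \<times> real \<Rightarrow> (real ^ 'k) \<times> real \<Rightarrow> real" where
  "cut_lhs B b = (\<lambda>(\<pi>, \<pi>\<^sub>0) (x, \<theta>). \<pi> \<bullet> (b - B *v x) - \<pi>\<^sub>0 * \<theta>)"

definition benders_cut ::
  "real ^ 'k ^ 'm \<Rightarrow> real ^ 'm \<Rightarrow> (real ^ 'm) \<times> real \<Rightarrow> ((real ^ 'k) \<times> real) set" where
  "benders_cut B b p = {z. cut_lhs B b p z \<le> 0}"

definition violates_cut ::
  "real ^ 'k ^ 'm \<Rightarrow> real ^ 'm \<Rightarrow> (real ^ 'm) \<times> real \<Rightarrow> (real ^ 'k) \<times> real \<Rightarrow> bool" where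
  "violates_cut B b p z \<longleftrightarrow> cut_lhs B b p z > 0"

text \<open>Optimal solutions of the cut selection problem at \<open>z'\<close> normalized by \<open>h\<close>.\<close>

definition cut_selection_opt ::
  "real ^ 'n \<Rightarrow> real ^ 'n ^ 'm \<Rightarrow> real ^ 'k ^ 'm \<Rightarrow> real ^ 'm \<Rightarrow> ((real ^ 'm) \<times> real \<Rightarrow> real)
    \<Rightarrow> (real ^ 'k) \<times> real \<Rightarrow> ((real ^ 'm) \<times> real) set" where
  "cut_selection_opt c A B b h z' =
     {p. is_arg_max (\<lambda>p. cut_lhs B b p z') (\<lambda>p. p \<in> cut_cone c A \<and> h p = 1) p}"

definition h_CW ::
  "real ^ 'k ^ 'm \<Rightarrow> (real ^ 'k) \<times> real \<Rightarrow> (real ^ 'k) \<times> real \<Rightarrow> (real ^ 'm) \<times> real \<Rightarrow> real" where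
  "h_CW B = (\<lambda>(xo, \<theta>o) (x', \<theta>') (\<pi>, \<pi>\<^sub>0). \<pi> \<bullet> (B *v (xo - x')) + \<pi>\<^sub>0 * (\<theta>o - \<theta>'))"

definition CW_opt ::
  "real ^ 'n \<Rightarrow> real ^ 'n ^ 'm \<Rightarrow> real ^ 'k ^ 'm \<Rightarrow> real ^ 'm
    \<Rightarrow> (real ^ 'k) \<times> real \<Rightarrow> (real ^ 'k) \<times> real \<Rightarrow> ((real ^ 'm) \<times> real) set" where
  "CW_opt c A B b zo z' = cut_selection_opt c A B b (h_CW B zo z') z'"

text \<open>
  The parameter \<open>\<beta>\<close> at which \<open>zo + \<beta> *\<^sub>R (z' - zo)\<close> meets the hyperplane
  \<open>cut_lhs B b p z = 0\<close>; only used where the denominator is positive.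
\<close>

definition intersection_parameter ::
  "real ^ 'k ^ 'm \<Rightarrow> real ^ 'm \<Rightarrow> (real ^ 'k) \<times> real \<Rightarrow> (real ^ 'k) \<times> real
    \<Rightarrow> (real ^ 'm) \<times> real \<Rightarrow> real" where
  "intersection_parameter B b = (\<lambda>(xo, \<theta>o) (x', \<theta>') (\<pi>, \<pi>\<^sub>0).
     (- (\<pi> \<bullet> (b - B *v xo)) + \<theta>o * \<pi>\<^sub>0) / (\<pi> \<bullet> (B *v (xo - x')) + \<pi>\<^sub>0 * (\<theta>o - \<theta>')))"

definition closest_cut_opt ::
  "real ^ 'n \<Rightarrow> real ^ 'n ^ 'm \<Rightarrow> real ^ 'k ^ 'm \<Rightarrow> real ^ 'm
    \<Rightarrow> (real ^ 'k) \<times> real \<Rightarrow> (real ^ 'k) \<times> real \<Rightarrow> ((real ^ 'm) \<times> real) set" where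
  "closest_cut_opt c A B b = (\<lambda>(xo, \<theta>o) (x', \<theta>').
     {p. is_arg_min (intersection_parameter B b (xo, \<theta>o) (x', \<theta>'))
           (\<lambda>(\<pi>, \<pi>\<^sub>0). (\<pi>, \<pi>\<^sub>0) \<in> cut_cone c A \<and>
              \<pi> \<bullet> (B *v (xo - x')) + \<pi>\<^sub>0 * (\<theta>o - \<theta>') > 0) p})"

end

theory Submission
  imports Defs
begin

text \<open>
  Since \<open>z' = zo + (z' - zo)\<close>, the left-hand side of a cut at \<open>z'\<close> is its value at \<open>zo\<close> plus
  \<open>h_CW\<close>. Hence \<open>\<beta> = 1 - cut_lhs / h_CW\<close>, with the left-hand side taken at \<open>z'\<close>, and minimizing
  \<open>\<beta>\<close> means maximizing a ratio of two linear functions over a cone; normalizing the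
  denominator to 1 gives the Conforti--Wolsey problem.
\<close>

text \<open>Both \<open>f\<close> and \<open>h\<close> are positively homogeneous, so
  \<open>f p / h p\<close> is constant along rays, and every ray with \<open>h > 0\<close> meets
  \<open>h = 1\<close> in exactly one point, where the ratio is \<open>f\<close> itself. Attainment
  is not assumed: the two sets may both be empty.\<close>

lemma arg_max_ratio_eq_scaled_arg_max_normalized:
  fixes C :: "'a::real_vector set" and f h :: "'a \<Rightarrow> real"
  assumes "cone C"
    and f: "\<And>t p. t > 0 \<Longrightarrow> f (t *\<^sub>R p) = t * f p"
    and h: "\<And>t p. t > 0 \<Longrightarrow> h (t *\<^sub>R p) = t * h p"
  shows "{p. is_arg_max (\<lambda>p. f p / h p) (\<lambda>p. p \<in> C \<and> h p > 0) p}
           = {t *\<^sub>R p | t p. t > 0 \<and> is_arg_max f (\<lambda>p. p \<in> C \<and> h p = 1) p}"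
    (is "?L = ?R")
proof (intro set_eqI iffI)
  have C: "t *\<^sub>R p \<in> C" if "p \<in> C" "t > 0" for t p
    using \<open>cone C\<close> that by (simp add: cone_def)
  fix p
  {
    assume "p \<in> ?L"
    then have p: "p \<in> C" "h p > 0"
      and max: "\<And>q. q \<in> C \<Longrightarrow> h q > 0 \<Longrightarrow> f q / h q \<le> f p / h p"
      by (auto simp: is_arg_max_linorder)
    \<comment> \<open>The point where the ray through \<open>p\<close> meets \<open>h = 1\<close>;
      the scalar that leads back to \<open>p\<close> is \<open>h p\<close>.\<close>
    let ?q = "inverse (h p) *\<^sub>R p"
    have "f ?q = f p / h p" "h ?q = 1" "?q \<in> C"
      using p by (simp_all add: f h C divide_inverse mult.commute)
    moreover have "f q \<le> f p / h p" if "q \<in> C" "h q = 1" for q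
      using max[of q] that by simp
    ultimately have "is_arg_max f (\<lambda>p. p \<in> C \<and> h p = 1) ?q"
      by (simp add: is_arg_max_linorder)
    moreover have "p = h p *\<^sub>R ?q"
      using p by simp
    ultimately show "p \<in> ?R"
      using p(2) by blast
  next
    assume "p \<in> ?R"
    then obtain t q where t: "t > 0" and p_eq: "p = t *\<^sub>R q" and q: "q \<in> C" "h q = 1"
      and max: "\<And>r. r \<in> C \<Longrightarrow> h r = 1 \<Longrightarrow> f r \<le> f q"
      by (auto simp: is_arg_max_linorder)
    \<comment> \<open>A competitor \<open>r\<close> is compared with \<open>q\<close> through its
      normalized multiple, at which \<open>f\<close> equals the ratio at \<open>r\<close>.\<close>
    have "f r / h r \<le> f q" if "r \<in> C" "h r > 0" for r
      using max[of "inverse (h r) *\<^sub>R r"] that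
      by (simp add: f h C divide_inverse mult.commute)
    then show "p \<in> ?L"
      using t q by (simp add: is_arg_max_linorder p_eq f h C)
  }
qed

lemma cone_cut_cone: "cone (cut_cone c A)"
  unfolding cone_def
proof (intro ballI allI impI)
  fix p and t :: real
  assume "p \<in> cut_cone c A" and t: "0 \<le> t"
  then obtain \<pi> \<pi>\<^sub>0 where p: "p = (\<pi>, \<pi>\<^sub>0)" "0 \<le> \<pi>" "0 \<le> \<pi>\<^sub>0"
    and "transpose A *v \<pi> - \<pi>\<^sub>0 *\<^sub>R c \<le> 0"
    by (auto simp: cut_cone_def)
  then have "t *\<^sub>R (transpose A *v \<pi> - \<pi>\<^sub>0 *\<^sub>R c) \<le> 0"
    using t by (simp add: less_eq_vec_def mult_nonneg_nonpos)
  then have "transpose A *v (t *\<^sub>R \<pi>) - (t * \<pi>\<^sub>0) *\<^sub>R c \<le> 0"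
    by (simp only: matrix_vector_mult_scaleR scaleR_diff_right scaleR_scaleR)
  moreover have "0 \<le> t *\<^sub>R \<pi>"
    using p t by (simp add: less_eq_vec_def)
  ultimately show "t *\<^sub>R p \<in> cut_cone c A"
    using p t by (simp add: cut_cone_def)
qed

lemma cut_lhs_scaleR: "cut_lhs B b (t *\<^sub>R p) z = t * cut_lhs B b p z"
  by (cases p; cases z) (simp add: cut_lhs_def algebra_simps)

lemma h_CW_scaleR: "h_CW B zo z' (t *\<^sub>R p) = t * h_CW B zo z' p"
  by (cases p; cases zo; cases z') (simp add: h_CW_def algebra_simps)

text \<open>A cut is identified with its half-space, so multipliers on one open ray give the same
  cut. Strictness of \<open>t > 0\<close> matters: \<open>t = 0\<close> would give the whole
  space.\<close>

lemma benders_cut_scaleR: "t > 0 \<Longrightarrow> benders_cut B b (t *\<^sub>R p) = benders_cut B b p"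
  by (simp add: benders_cut_def cut_lhs_scaleR mult_le_0_iff)

lemma cut_lhs_eq_add_h_CW: "cut_lhs B b p z' = cut_lhs B b p zo + h_CW B zo z' p"
  by (cases p; cases zo; cases z')
    (simp add: cut_lhs_def h_CW_def matrix_vector_mult_diff_distrib inner_diff_right algebra_simps)

lemma intersection_parameter_eq:
  assumes "h_CW B zo z' p > 0"
  shows "intersection_parameter B b zo z' p = 1 - cut_lhs B b p z' / h_CW B zo z' p"
proof -
  \<comment> \<open>The numerator of \<beta> is the slack of the cut at the guiding point
    \<open>zo\<close>.\<close>
  have "intersection_parameter B b zo z' p = - cut_lhs B b p zo / h_CW B zo z' p"
    by (cases p; cases zo; cases z')
      (simp add: intersection_parameter_def cut_lhs_def h_CW_def mult.commute)
  then show ?thesis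
    using assms by (simp add: cut_lhs_eq_add_h_CW[of B b p z' zo] field_simps)
qed

lemma closest_cut_opt_eq_arg_max_ratio:
  "closest_cut_opt c A B b zo z'
     = {p. is_arg_max (\<lambda>p. cut_lhs B b p z' / h_CW B zo z' p)
             (\<lambda>p. p \<in> cut_cone c A \<and> h_CW B zo z' p > 0) p}"
proof -
  have "closest_cut_opt c A B b zo z'
     = {p. is_arg_min (intersection_parameter B b zo z')
             (\<lambda>p. p \<in> cut_cone c A \<and> h_CW B zo z' p > 0) p}"
    by (cases zo; cases z') (simp add: closest_cut_opt_def h_CW_def case_prod_unfold)
  \<comment> \<open>On the common feasible set the denominator is positive, so the objective is 1
    minus the ratio and the order of values is reversed.\<close>
  then show ?thesis
    by (auto simp: is_arg_min_linorder is_arg_max_linorder intersection_parameter_eq)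
qed

lemma closest_cut_opt_eq_scaled_CW_opt:
  "closest_cut_opt c A B b zo z' = {t *\<^sub>R p | t p. t > 0 \<and> p \<in> CW_opt c A B b zo z'}"
  unfolding closest_cut_opt_eq_arg_max_ratio CW_opt_def cut_selection_opt_def mem_Collect_eq
  by (intro arg_max_ratio_eq_scaled_arg_max_normalized cone_cut_cone cut_lhs_scaleR h_CW_scaleR)

theorem proposition3:
  fixes c :: "real ^ 'n" and A :: "real ^ 'n ^ 'm" and B :: "real ^ 'k ^ 'm" and b :: "real ^ 'm"
    and X :: "(real ^ 'k) set" and xo x' :: "real ^ 'k" and \<theta>o \<theta>' :: real
  assumes "0 \<le> c"
    and "X \<subseteq> {x. 0 \<le> x}"
    and "(xo, \<theta>o) \<in> value_epigraph c A B b"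
    and "x' \<in> X" and "0 \<le> \<theta>'"
    and "\<exists>p \<in> cut_cone c A. violates_cut B b p (x', \<theta>')"
  shows "closest_cut_opt c A B b (xo, \<theta>o) (x', \<theta>')
           = {t *\<^sub>R p | t p. t > 0 \<and> p \<in> CW_opt c A B b (xo, \<theta>o) (x', \<theta>')}
         \<and> (\<forall>t p. t > 0 \<longrightarrow> benders_cut B b (t *\<^sub>R p) = benders_cut B b p)
         \<and> benders_cut B b ` closest_cut_opt c A B b (xo, \<theta>o) (x', \<theta>')
           = benders_cut B b ` CW_opt c A B b (xo, \<theta>o) (x', \<theta>')"
proof (intro conjI allI impI)
  let ?CW = "CW_opt c A B b (xo, \<theta>o) (x', \<theta>')"
  show closest: "closest_cut_opt c A B b (xo, \<theta>o) (x', \<theta>') = {t *\<^sub>R p | t p. t > 0 \<and> p \<in> ?CW}"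
    by (rule closest_cut_opt_eq_scaled_CW_opt)
  show "benders_cut B b (t *\<^sub>R p) = benders_cut B b p" if "t > 0" for t p
    using that by (rule benders_cut_scaleR)
  \<comment> \<open>The scalar \<open>t = 1\<close> shows that closing under positive multiples
    loses no multiplier.\<close>
  have "p \<in> {t *\<^sub>R p | t p. t > 0 \<and> p \<in> ?CW}" if "p \<in> ?CW" for p
    using that scaleR_one[of p] zero_less_one by (metis (mono_tags, lifting) mem_Collect_eq)
  then have "?CW \<subseteq> {t *\<^sub>R p | t p. t > 0 \<and> p \<in> ?CW}"
    by (rule subsetI)
  \<comment> \<open>Conversely, the added multiples contribute no new half-space.\<close>
  moreover have "benders_cut B b q \<in> benders_cut B b ` ?CW"
    if "q \<in> {t *\<^sub>R p | t p. t > 0 \<and> p \<in> ?CW}" for q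
    using that benders_cut_scaleR[of _ B b] by blast
  ultimately show "benders_cut B b ` closest_cut_opt c A B b (xo, \<theta>o) (x', \<theta>') = benders_cut B b ` ?CW"
    unfolding closest by blast
qed

end
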